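(* Let $K\subset \mathbb{C}$ be a field, and let $n\geq 2$ and $d\geq 3$ be integers such that there exists an integer $q$ with $2\leq q\leq n$ and $q\mid d$. Then there exists a homogeneous polynomial $f\in K[x_1,\ldots,x_n]$ of degree $d$ such that $H(f)=\alpha (x_1\cdots x_n)^{d-2}$ for some $\alpha\in K$, $\alpha\neq 0$, but $f$ is not of the form $\alpha_1x_1^d+\cdots+\alpha_nx_n^d$ with $\alpha_1,\ldots,\alpha_n\in K$.
   Context: For a homogeneous polynomial $f\in \mathbb{C}[x_1,\ldots,x_n]$, $\mathrm{Hess}(f)=\left(\frac{\partial^2 f}{\partial x_i\partial x_j}\right)_{1\le i,j\le n}$ is the Hessian matrix and $H(f)=\det(\mathrm{Hess}(f))$ is the Hessian determinant. *)

theory Defs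
  imports
    "HOL-Library.Poly_Mapping"
    "HOL-Algebra.Algebraic_Closure_Type"
    "Jordan_Normal_Form.Determinant"
begin

text \<open>
  Complex polynomials in countably many indeterminates: a monomial is a finitely supported
  exponent function, a polynomial a finitely supported function from monomials to coefficients,
  with the ring structure (convolution product) of the library theory on polynomial mappings.
  The indeterminates are indexed from 0, so that \<open>Var 0, \<dots>, Var (n - 1)\<close>
  stand for $x_1, \ldots, x_n$, in accordance with the indexing of matrices.
\<close>

type_synonym cmpoly = "(nat \<Rightarrow>\<^sub>0 nat) \<Rightarrow>\<^sub>0 complex"

definition Var :: "nat \<Rightarrow> cmpoly" where
  "Var i = Poly_Mapping.single (Poly_Mapping.single i 1) 1"

definition Const :: "complex \<Rightarrow> cmpoly" where
  "Const a = Poly_Mapping.single 0 a"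

definition mpoly_over :: "complex set \<Rightarrow> nat \<Rightarrow> cmpoly set" where
  "mpoly_over K n = {p. \<forall>m \<in> Poly_Mapping.keys p.
     Poly_Mapping.keys m \<subseteq> {..<n} \<and> Poly_Mapping.lookup p m \<in> K}"

definition total_deg :: "(nat \<Rightarrow>\<^sub>0 nat) \<Rightarrow> nat" where
  "total_deg m = (\<Sum>i\<in>Poly_Mapping.keys m. Poly_Mapping.lookup m i)"

text \<open>As usual, the zero polynomial counts as homogeneous of every degree.\<close>

definition homogeneous :: "nat \<Rightarrow> cmpoly \<Rightarrow> bool" where
  "homogeneous d p \<longleftrightarrow> (\<forall>m \<in> Poly_Mapping.keys p. total_deg m = d)"

text \<open>
  Formal partial derivative, term by term. The subtraction of exponents is truncated, which is
  harmless: where it truncates, the factor \<open>lookup m i\<close> is 0.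
\<close>

definition pdiff :: "nat \<Rightarrow> cmpoly \<Rightarrow> cmpoly" where
  "pdiff i p = (\<Sum>m\<in>Poly_Mapping.keys p.
     Poly_Mapping.single (m - Poly_Mapping.single i 1)
       (of_nat (Poly_Mapping.lookup m i) * Poly_Mapping.lookup p m))"

definition hessian_matrix :: "nat \<Rightarrow> cmpoly \<Rightarrow> cmpoly mat" where
  "hessian_matrix n f = mat n n (\<lambda>(i, j). pdiff i (pdiff j f))"

definition hessian_det :: "nat \<Rightarrow> cmpoly \<Rightarrow> cmpoly" where
  "hessian_det n f = det (hessian_matrix n f)"

end

theory Submission
  imports Defs
begin

text \<open>
  If \<open>d = q e\<close>, then the polynomial
  \[ f = (x_1 \cdots x_q)^e + x_{q+1}^d + \cdots + x_n^d \]
  has the required Hessian determinant. The monomials of \<open>f\<close> involve disjoint sets of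
  variables, and every variable \<open>x\<^sub>j\<close> occurs in exactly one of them, say in
  \<open>t\<^sub>j\<close>. Hence the \<open>(i, j)\<close> entry of the Hessian matrix is a multiple
  \<open>c\<^sub>i\<^sub>j t\<^sub>j / (x\<^sub>i x\<^sub>j)\<close> of a single Laurent monomial, where
  \<open>c\<^sub>i\<^sub>j\<close> is an integer. A matrix of this shape is the constant matrix
  \<open>(c\<^sub>i\<^sub>j)\<close> with rows scaled by \<open>1 / x\<^sub>i\<close> and columns scaled by
  \<open>t\<^sub>j / x\<^sub>j\<close>, so its determinant is
  \[ \det(c_{ij}) \cdot \frac{t_1 \cdots t_n}{(x_1 \cdots x_n)^2}
     = \det(c_{ij}) \cdot (x_1 \cdots x_n)^{d-2}, \]
  because \<open>t\<^sub>1 \<cdots> t\<^sub>n\<close> consists of \<open>q\<close> factors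
  \<open>(x\<^sub>1 \<cdots> x\<^sub>q)\<^sup>e\<close> and of the pure powers. This is
  \<open>det_single_entries\<close>, stated there without Laurent monomials.

  The integer matrix \<open>(c\<^sub>i\<^sub>j)\<close> is block diagonal, with blocks
  \<open>e\<^sup>2 J - e I\<close> of size \<open>q\<close> (\<open>J\<close> being the all-ones matrix) and
  \<open>d (d - 1) I\<close>. The eigenvalues of the first block are \<open>-e\<close> and
  \<open>q e\<^sup>2 - e = e (d - 1)\<close>, so the determinant does not vanish; this is
  \<open>det_hessian_coeff_nonzero\<close>. Finally \<open>f\<close> is not diagonal, since
  \<open>q \<ge> 2\<close> makes \<open>(x\<^sub>1 \<cdots> x\<^sub>q)\<^sup>e\<close> a mixed monomial.
\<close>

section \<open>Sums of distinct monomials\<close>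

definition sum_of_monomials :: "(nat \<Rightarrow>\<^sub>0 nat) set \<Rightarrow> cmpoly" where
  "sum_of_monomials T = (\<Sum>t\<in>T. Poly_Mapping.single t 1)"

lemma lookup_sum_of_monomials:
  assumes "finite T"
  shows "Poly_Mapping.lookup (sum_of_monomials T) m = (if m \<in> T then 1 else 0)"
  using assms by (simp add: sum_of_monomials_def lookup_sum lookup_single when_def)

lemma keys_sum_of_monomials:
  assumes "finite T"
  shows "Poly_Mapping.keys (sum_of_monomials T) = T"
  by (auto simp: in_keys_iff lookup_sum_of_monomials[OF assms] split: if_splits)

lemma pdiff_single:
  "pdiff i (Poly_Mapping.single m c) =
     Poly_Mapping.single (m - Poly_Mapping.single i 1) (of_nat (Poly_Mapping.lookup m i) * c)"
  by (simp add: pdiff_def)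

lemma pdiff_sum_of_monomials:
  assumes "finite T" and "t \<in> T" and "\<And>s. s \<in> T \<Longrightarrow> s \<noteq> t \<Longrightarrow> Poly_Mapping.lookup s j = 0"
  shows "pdiff j (sum_of_monomials T) = pdiff j (Poly_Mapping.single t 1)"
proof -
  have "pdiff j (sum_of_monomials T) =
      (\<Sum>s\<in>T. Poly_Mapping.single (s - Poly_Mapping.single j 1) (of_nat (Poly_Mapping.lookup s j)))"
    by (simp add: pdiff_def keys_sum_of_monomials lookup_sum_of_monomials assms(1))
  also have "\<dots> =
      (\<Sum>s\<in>{t}. Poly_Mapping.single (s - Poly_Mapping.single j 1) (of_nat (Poly_Mapping.lookup s j)))"
    using assms by (intro sum.mono_neutral_right) auto
  finally show ?thesis
    by (simp add: pdiff_single)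
qed

lemma prod_single:
  "(\<Prod>i\<in>A. Poly_Mapping.single (m i) (c i)) =
     Poly_Mapping.single (\<Sum>i\<in>A. m i) (\<Prod>i\<in>A. c i :: 'b :: comm_semiring_1)"
  for m :: "'i \<Rightarrow> 'a :: comm_monoid_add"
  by (induction A rule: infinite_finite_induct) (simp_all add: mult_single)

lemma Var_power: "Var i ^ k = Poly_Mapping.single (Poly_Mapping.single i k) 1"
  by (induction k) (simp_all add: Var_def mult_single flip: single_add)

lemma lookup_sum_single:
  assumes "finite A"
  shows "Poly_Mapping.lookup (\<Sum>i\<in>A. Poly_Mapping.single i (k :: nat)) j = (if j \<in> A then k else 0)"
  using assms by (simp add: lookup_sum lookup_single when_def)

section \<open>Determinants of scaled constant matrices\<close>

lemma det_mat_leibniz: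
  "det (mat n n (\<lambda>(i, j). A i j)) =
     (\<Sum>p | p permutes {0..<n}. signof p * (\<Prod>i = 0..<n. A i (p i)))"
proof -
  have "(\<Prod>i = 0..<n. mat n n (\<lambda>(i, j). A i j) $$ (i, p i)) = (\<Prod>i = 0..<n. A i (p i))"
    if "p permutes {0..<n}" for p
    using that permutes_in_image[OF that] by (intro prod.cong) auto
  then show ?thesis
    by (simp add: det_def)
qed

text \<open>
  The hypothesis on exponents says that entry \<open>(i, j)\<close> is
  \<open>c i j\<close> times \<open>x\<^sup>w\<^sup>j / (x\<^sup>r\<^sup>i x\<^sup>s\<^sup>j)\<close>. Each summand of the
  Leibniz expansion picks every row and every column once, so all nonzero summands carry the same
  monomial \<open>x\<^sup>\<mu>\<close>. Negative exponents are avoided by adding the denominators to the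
  other side, which is why the exponents have to be cancellable.
\<close>

lemma det_single_entries:
  fixes m :: "nat \<Rightarrow> nat \<Rightarrow> 'a :: cancel_comm_monoid_add"
    and c :: "nat \<Rightarrow> nat \<Rightarrow> 'b :: comm_ring_1"
  assumes exponents: "\<And>i j. i < n \<Longrightarrow> j < n \<Longrightarrow> c i j \<noteq> 0 \<Longrightarrow> m i j + (r i + s j) = w j"
    and total: "\<mu> + (sum r {..<n} + sum s {..<n}) = sum w {..<n}"
  shows "det (mat n n (\<lambda>(i, j). Poly_Mapping.single (m i j) (c i j))) =
    Poly_Mapping.single \<mu> (det (mat n n (\<lambda>(i, j). c i j)))"
proof -
  have summand: "signof p * (\<Prod>i = 0..<n. Poly_Mapping.single (m i (p i)) (c i (p i))) =
      Poly_Mapping.single \<mu> (signof p * (\<Prod>i = 0..<n. c i (p i)))"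
    if p: "p permutes {0..<n}" for p
  proof (cases "\<exists>i\<in>{0..<n}. c i (p i) = 0")
    case True
    then have "(\<Prod>i = 0..<n. c i (p i)) = 0"
      by (auto intro!: prod_zero)
    then show ?thesis
      by (simp add: prod_single)
  next
    case False
    have reindex: "(\<Sum>i = 0..<n. g (p i)) = sum g {..<n}" for g :: "nat \<Rightarrow> 'a"
      using p by (simp add: sum.permute[of p _ g] comp_def flip: atLeast0LessThan)
    have "m i (p i) + (r i + s (p i)) = w (p i)" if "i \<in> {0..<n}" for i
      using that p False permutes_in_image[of p "{0..<n}" i] by (intro exponents) auto
    then have "(\<Sum>i = 0..<n. m i (p i) + (r i + s (p i))) = (\<Sum>i = 0..<n. w (p i))"
      by (rule sum.cong[OF refl])
    then have "(\<Sum>i = 0..<n. m i (p i)) + (sum r {..<n} + sum s {..<n}) = sum w {..<n}"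
      by (simp add: sum.distrib atLeast0LessThan reindex[unfolded atLeast0LessThan])
    then have "(\<Sum>i = 0..<n. m i (p i)) = \<mu>"
      using total by (metis add_right_cancel)
    then show ?thesis
      by (simp add: prod_single sign_def single_uminus)
  qed
  have single_sum: "Poly_Mapping.single \<mu> (sum h A) = (\<Sum>p\<in>A. Poly_Mapping.single \<mu> (h p))"
    for h :: "(nat \<Rightarrow> nat) \<Rightarrow> 'b" and A
    by (induction A rule: infinite_finite_induct) (simp_all add: single_add)
  show ?thesis
    unfolding det_mat_leibniz single_sum using summand by (intro sum.cong) auto
qed

lemma det_in_subring:
  fixes K :: "'a :: comm_ring_1 set"
  assumes K: "subring K (ring_of_type_algebra :: 'a ring)"
    and entries: "\<And>i j. i < n \<Longrightarrow> j < n \<Longrightarrow> c i j \<in> K"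
  shows "det (mat n n (\<lambda>(i, j). c i j)) \<in> K"
proof -
  note closed = subringE[OF K]
  have zero: "0 \<in> K" and one: "1 \<in> K"
    using closed(2,3) by (simp_all add: ring_of_type_algebra_def)
  have add: "x + y \<in> K" and mult: "x * y \<in> K" if "x \<in> K" "y \<in> K" for x y
    using closed(6,7) that by (simp_all add: ring_of_type_algebra_def)
  have uminus: "- x \<in> K" if "x \<in> K" for x
  proof -
    have "x + \<ominus>\<^bsub>ring_of_type_algebra\<^esub> x = 0"
      using abelian_group.r_neg[OF ring.is_abelian_group[OF ring_from_type_algebra], of x]
      by (simp add: ring_of_type_algebra_def)
    then have "- x = \<ominus>\<^bsub>ring_of_type_algebra\<^esub> x"
      by (rule minus_unique)
    then show ?thesis
      using closed(5)[OF that] by simp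
  qed
  have sum: "sum h A \<in> K" if "\<And>x. x \<in> A \<Longrightarrow> h x \<in> K" for h :: "(nat \<Rightarrow> nat) \<Rightarrow> 'a" and A
    using that by (induction A rule: infinite_finite_induct) (auto intro: zero add)
  have prod: "prod h A \<in> K" if "\<And>x. x \<in> A \<Longrightarrow> h x \<in> K" for h :: "nat \<Rightarrow> 'a" and A
    using that by (induction A rule: infinite_finite_induct) (auto intro: one mult)
  have "signof p * (\<Prod>i = 0..<n. c i (p i)) \<in> K" if p: "p permutes {0..<n}" for p
  proof -
    have "(\<Prod>i = 0..<n. c i (p i)) \<in> K"
      using permutes_in_image[OF p] by (intro prod entries) auto
    then show ?thesis
      by (simp add: sign_def uminus)
  qed
  then show ?thesis
    unfolding det_mat_leibniz by (intro sum) auto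
qed

text \<open>
  On a vector of the kernel, the rows below \<open>q\<close> say that \<open>a S + \<beta> v\<^sub>i = 0\<close>, where
  \<open>S\<close> is the sum of the first \<open>q\<close> coordinates. Adding them up gives
  \<open>(q a + \<beta>) S = 0\<close>, so \<open>S\<close> and with it every coordinate vanishes.
\<close>

lemma det_constant_block_plus_diagonal_nonzero:
  fixes a \<beta> :: "'a :: field" and b :: "nat \<Rightarrow> 'a"
  assumes "q \<le> n" and b_block: "\<And>i. i < q \<Longrightarrow> b i = \<beta>" and b_nonzero: "\<And>i. i < n \<Longrightarrow> b i \<noteq> 0"
    and eigenvalue: "of_nat q * a + \<beta> \<noteq> 0"
  shows "det (mat n n (\<lambda>(i, j). (if i < q \<and> j < q then a else 0) + (if i = j then b i else 0))) \<noteq> 0"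
    (is "det ?C \<noteq> 0")
proof
  assume "det ?C = 0"
  moreover have "?C \<in> carrier_mat n n"
    by simp
  ultimately obtain v where v: "v \<in> carrier_vec n" "v \<noteq> 0\<^sub>v n" "?C *\<^sub>v v = 0\<^sub>v n"
    using det_0_iff_vec_prod_zero_field by blast
  define S where "S = (\<Sum>j<q. v $ j)"
  have row: "(if i < q then a * S else 0) + b i * v $ i = 0" if "i < n" for i
  proof -
    have "0 = (?C *\<^sub>v v) $ i"
      using v(3) that by simp
    also have "\<dots> = (\<Sum>j = 0..<n.
        ((if i < q \<and> j < q then a else 0) + (if i = j then b i else 0)) * v $ j)"
      using that v(1) by (simp add: scalar_prod_def)
    also have "\<dots> = (\<Sum>j<n. if j < q then if i < q then a * v $ j else 0 else 0)
        + (\<Sum>j<n. if i = j then b i * v $ j else 0)"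
      unfolding sum.distrib[symmetric] atLeast0LessThan by (intro sum.cong) (auto simp: distrib_right)
    also have "(\<Sum>j<n. if j < q then if i < q then a * v $ j else 0 else 0) =
        (\<Sum>j<q. if i < q then a * v $ j else 0)"
      using \<open>q \<le> n\<close> by (intro sum.mono_neutral_cong_right) auto
    also have "\<dots> = (if i < q then a * S else 0)"
      by (simp add: S_def sum_distrib_left)
    also have "(\<Sum>j<n. if i = j then b i * v $ j else 0) = b i * v $ i"
      using that by simp
    finally show ?thesis
      by simp
  qed
  have "0 = (\<Sum>i<q. a * S + \<beta> * v $ i)"
  proof -
    have "a * S + \<beta> * v $ i = 0" if "i < q" for i
      using row[of i] b_block[of i] that \<open>q \<le> n\<close> by simp
    then show ?thesis by simp
  qed
  also have "\<dots> = (of_nat q * a + \<beta>) * S"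
    by (simp add: sum.distrib S_def algebra_simps flip: sum_distrib_left)
  finally have "S = 0"
    using eigenvalue by simp
  then have "v $ i = 0" if "i < n" for i
    using row[OF that] b_nonzero[OF that] by (simp split: if_splits)
  then have "v = 0\<^sub>v n"
    using v(1) by auto
  then show False
    using v(2) by contradiction
qed

section \<open>One block of variables and pure powers\<close>

text \<open>
  The exponents of \<open>t\<^sub>j\<close>, the only monomial of
  \<open>(x\<^sub>1 \<cdots> x\<^sub>q)\<^sup>e + x\<^sub>q\<^sub>+\<^sub>1\<^sup>d + \<cdots>\<close> in which
  the variable \<open>x\<^sub>j\<close> occurs.
\<close>

definition block_monomial :: "nat \<Rightarrow> nat \<Rightarrow> nat \<Rightarrow> nat \<Rightarrow> (nat \<Rightarrow>\<^sub>0 nat)" where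
  "block_monomial q e d j =
     (if j < q then \<Sum>i<q. Poly_Mapping.single i e else Poly_Mapping.single j d)"

lemma lookup_block_monomial:
  "Poly_Mapping.lookup (block_monomial q e d j) i =
     (if j < q then if i < q then e else 0 else if i = j then d else 0)"
  by (simp add: block_monomial_def lookup_sum_single lookup_single when_def)

lemma keys_block_monomial:
  "Poly_Mapping.keys (block_monomial q e d j) \<subseteq> (if j < q then {..<q} else {j})"
  by (auto simp: in_keys_iff lookup_block_monomial split: if_splits)

lemma total_deg_block_monomial:
  assumes "d = q * e"
  shows "total_deg (block_monomial q e d j) = d"
proof -
  have "total_deg (block_monomial q e d j) =
      (\<Sum>i\<in>(if j < q then {..<q} else {j}). Poly_Mapping.lookup (block_monomial q e d j) i)"
    unfolding total_deg_def using keys_block_monomial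
    by (intro sum.mono_neutral_left) (auto simp: in_keys_iff)
  then show ?thesis
    using assms by (simp add: lookup_block_monomial)
qed

text \<open>
  A variable of the block has exponent \<open>e\<close> in each of the \<open>q\<close> equal factors
  \<open>t\<^sub>1, \<dots>, t\<^sub>q\<close>, hence total exponent \<open>q e = d\<close>, just as the other variables.
\<close>

lemma sum_block_monomial:
  assumes "d = q * e" and "q \<le> n"
  shows "(\<Sum>j<n. block_monomial q e d j) = (\<Sum>j<n. Poly_Mapping.single j d)"
proof (rule poly_mapping_eqI)
  fix k
  have "(\<Sum>j<n. Poly_Mapping.lookup (block_monomial q e d j) k) = (if k < n then d else 0)"
  proof (cases "k < q")
    case True
    then have "(\<Sum>j<n. Poly_Mapping.lookup (block_monomial q e d j) k) = (\<Sum>j<q. e)"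
      using \<open>q \<le> n\<close> by (intro sum.mono_neutral_cong_right) (auto simp: lookup_block_monomial)
    then show ?thesis
      using True assms by simp
  next
    case False
    then have "(\<Sum>j<n. Poly_Mapping.lookup (block_monomial q e d j) k) =
        (\<Sum>j<n. if k = j then d else 0)"
      by (intro sum.cong) (auto simp: lookup_block_monomial)
    then show ?thesis
      by simp
  qed
  then show "Poly_Mapping.lookup (\<Sum>j<n. block_monomial q e d j) k =
      Poly_Mapping.lookup (\<Sum>j<n. Poly_Mapping.single j d) k"
    by (simp add: lookup_sum lookup_sum_single[unfolded lookup_sum])
qed

definition block_poly :: "nat \<Rightarrow> nat \<Rightarrow> nat \<Rightarrow> nat \<Rightarrow> cmpoly" where
  "block_poly n q e d = sum_of_monomials (block_monomial q e d ` {..<n})"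

lemma pdiff_block_poly:
  assumes "j < n"
  shows "pdiff j (block_poly n q e d) = pdiff j (Poly_Mapping.single (block_monomial q e d j) 1)"
  unfolding block_poly_def
proof (rule pdiff_sum_of_monomials)
  fix s
  assume "s \<in> block_monomial q e d ` {..<n}" "s \<noteq> block_monomial q e d j"
  then obtain k where k: "s = block_monomial q e d k"
      "block_monomial q e d k \<noteq> block_monomial q e d j"
    by auto
  then have "\<not> (k < q \<and> j < q)" and "k \<noteq> j"
    by (auto simp: block_monomial_def)
  then show "Poly_Mapping.lookup s j = 0"
    by (simp add: k(1) lookup_block_monomial)
qed (use assms in auto)

text \<open>
  The coefficient of \<open>t\<^sub>j / (x\<^sub>i x\<^sub>j)\<close> in the second derivative, written as constant
  block plus diagonal matrix. On the block, the diagonal \<open>-e\<close> turns \<open>e\<^sup>2\<close> into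
  \<open>e (e - 1)\<close>.
\<close>

definition hessian_coeff :: "nat \<Rightarrow> nat \<Rightarrow> nat \<Rightarrow> nat \<Rightarrow> nat \<Rightarrow> complex" where
  "hessian_coeff q e d i j = (if i < q \<and> j < q then of_nat e ^ 2 else 0) +
     (if i = j then if i < q then - of_nat e else of_nat d * (of_nat d - 1) else 0)"

lemma hessian_coeff_eq:
  assumes "e \<ge> 1" and "d \<ge> 1"
  shows "hessian_coeff q e d i j =
    of_nat (Poly_Mapping.lookup (block_monomial q e d j - Poly_Mapping.single j 1) i *
      Poly_Mapping.lookup (block_monomial q e d j) j)"
  using assms
  by (auto simp: hessian_coeff_def lookup_minus lookup_block_monomial lookup_single when_def
      of_nat_diff power2_eq_square algebra_simps)

lemma hessian_entry_block_poly:
  assumes "e \<ge> 1" and "d \<ge> 1" and "j < n"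
  shows "pdiff i (pdiff j (block_poly n q e d)) =
    Poly_Mapping.single (block_monomial q e d j - Poly_Mapping.single j 1 - Poly_Mapping.single i 1)
      (hessian_coeff q e d i j)"
  using assms by (simp add: pdiff_block_poly pdiff_single hessian_coeff_eq)

text \<open>
  A nonzero coefficient means that \<open>x\<^sub>i x\<^sub>j\<close> divides \<open>t\<^sub>j\<close>, so that no
  exponent is truncated by the subtractions.
\<close>

lemma hessian_coeff_exponents:
  assumes "e \<ge> 1" and "d \<ge> 1" and "hessian_coeff q e d i j \<noteq> 0"
  shows "block_monomial q e d j - Poly_Mapping.single j 1 - Poly_Mapping.single i 1
    + (Poly_Mapping.single i 1 + Poly_Mapping.single j 1) = block_monomial q e d j"
proof (rule poly_mapping_eqI)
  fix k
  have "Poly_Mapping.lookup (block_monomial q e d j - Poly_Mapping.single j 1) i \<noteq> 0"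
    and "Poly_Mapping.lookup (block_monomial q e d j) j \<noteq> 0"
    using assms(3) unfolding hessian_coeff_eq[OF assms(1,2)] by auto
  then show "Poly_Mapping.lookup (block_monomial q e d j
      - Poly_Mapping.single j 1 - Poly_Mapping.single i 1
      + (Poly_Mapping.single i 1 + Poly_Mapping.single j 1)) k =
    Poly_Mapping.lookup (block_monomial q e d j) k"
    by (auto simp: lookup_add lookup_minus lookup_single when_def split: if_splits)
qed

lemma det_hessian_coeff_nonzero:
  assumes "d = q * e" and "d \<ge> 2" and "q \<le> n"
  shows "det (mat n n (\<lambda>(i, j). hessian_coeff q e d i j)) \<noteq> 0"
  unfolding hessian_coeff_def
proof (rule det_constant_block_plus_diagonal_nonzero[where \<beta> = "- of_nat e"])
  have e: "(of_nat e :: complex) \<noteq> 0"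
    using assms(1,2) by (cases e) (auto simp del: of_nat_Suc)
  have d: "(of_nat d :: complex) \<noteq> 0" "(of_nat d :: complex) \<noteq> 1"
    using \<open>d \<ge> 2\<close> of_nat_eq_1_iff[of d, where 'a = complex] by auto
  show "(if i < q then - of_nat e else of_nat d * (of_nat d - 1) :: complex) \<noteq> 0" for i
    using e d by simp
  have "of_nat q * of_nat e ^ 2 + - of_nat e = (of_nat e * (of_nat d - 1) :: complex)"
    by (simp add: assms(1) power2_eq_square algebra_simps)
  then show "of_nat q * of_nat e ^ 2 + - of_nat e \<noteq> (0 :: complex)"
    using e d by simp
qed (use assms in auto)

lemma hessian_det_block_poly:
  assumes "d = q * e" and "d \<ge> 2" and "q \<le> n"
  shows "hessian_det n (block_poly n q e d) =
    Const (det (mat n n (\<lambda>(i, j). hessian_coeff q e d i j))) * (\<Prod>i<n. Var i) ^ (d - 2)"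
proof -
  let ?unit = "\<lambda>i. Poly_Mapping.single i 1 :: nat \<Rightarrow>\<^sub>0 nat"
  let ?\<mu> = "\<Sum>i<n. Poly_Mapping.single i (d - 2)"
  have e: "e \<ge> 1"
    using assms by (cases e) auto
  have "hessian_matrix n (block_poly n q e d) =
      mat n n (\<lambda>(i, j). Poly_Mapping.single (block_monomial q e d j - ?unit j - ?unit i)
        (hessian_coeff q e d i j))"
    using assms(2) e unfolding hessian_matrix_def
    by (intro cong_mat) (simp_all add: hessian_entry_block_poly)
  moreover have "det \<dots> = Poly_Mapping.single ?\<mu> (det (mat n n (\<lambda>(i, j). hessian_coeff q e d i j)))"
  proof (rule det_single_entries[where r = ?unit and s = ?unit])
    show "block_monomial q e d j - ?unit j - ?unit i + (?unit i + ?unit j) = block_monomial q e d j"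
      if "hessian_coeff q e d i j \<noteq> 0" for i j
      using that e assms(2) by (intro hessian_coeff_exponents) auto
    have "?\<mu> + (sum ?unit {..<n} + sum ?unit {..<n}) = (\<Sum>j<n. Poly_Mapping.single j d)"
      unfolding sum.distrib[symmetric] single_add[symmetric]
      using \<open>d \<ge> 2\<close> by (intro sum.cong) (simp_all flip: Suc_diff_le)
    then show "?\<mu> + (sum ?unit {..<n} + sum ?unit {..<n}) = sum (block_monomial q e d) {..<n}"
      by (simp add: sum_block_monomial[OF assms(1,3)])
  qed
  moreover have "(\<Prod>i<n. Var i) ^ (d - 2) = Poly_Mapping.single ?\<mu> 1"
    by (simp add: prod_power_distrib Var_power prod_single)
  ultimately show ?thesis
    by (simp add: hessian_det_def Const_def mult_single)
qed

text \<open>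
  The coefficient of \<open>(x\<^sub>1 \<cdots> x\<^sub>q)\<^sup>e\<close> is 1 in the block polynomial and 0 in every
  diagonal form, because this monomial contains two different variables.
\<close>

lemma block_poly_not_diagonal:
  assumes "2 \<le> q" and "q \<le> n" and "e \<ge> 1"
  shows "block_poly n q e d \<noteq> (\<Sum>i<n. Const (a i) * Var i ^ d)"
proof
  let ?t = "block_monomial q e d 0"
  assume eq: "block_poly n q e d = (\<Sum>i<n. Const (a i) * Var i ^ d)"
  have "Poly_Mapping.single i d \<noteq> ?t" for i
  proof
    assume *: "Poly_Mapping.single i d = ?t"
    have "Poly_Mapping.lookup ?t 0 = e" "Poly_Mapping.lookup ?t 1 = e"
      using assms by (simp_all add: lookup_block_monomial)
    then show False
      using \<open>e \<ge> 1\<close> unfolding *[symmetric] by (auto simp: lookup_single when_def split: if_splits)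
  qed
  then have "Poly_Mapping.lookup (\<Sum>i<n. Const (a i) * Var i ^ d) ?t = 0"
    by (simp add: lookup_sum Const_def Var_power mult_single lookup_single)
  moreover have "Poly_Mapping.lookup (block_poly n q e d) ?t = 1"
    using assms by (simp add: block_poly_def lookup_sum_of_monomials)
  ultimately show False
    using eq by simp
qed

theorem theorem2p1:
  fixes K :: "complex set" and n d :: nat
  assumes "subfield K (ring_of_type_algebra :: complex ring)"
    and "n \<ge> 2" and "d \<ge> 3"
    and "\<exists>q::nat. 2 \<le> q \<and> q \<le> n \<and> q dvd d"
  shows "\<exists>f \<in> mpoly_over K n. homogeneous d f \<and>
    (\<exists>\<alpha>\<in>K. \<alpha> \<noteq> 0 \<and> hessian_det n f = Const \<alpha> * (\<Prod>i<n. Var i) ^ (d - 2)) \<and>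
    \<not> (\<exists>a :: nat \<Rightarrow> complex. (\<forall>i<n. a i \<in> K) \<and> f = (\<Sum>i<n. Const (a i) * Var i ^ d))"
proof -
  obtain q e where q: "2 \<le> q" "q \<le> n" and d: "d = q * e"
    using assms(4) by auto
  have e: "e \<ge> 1"
    using d \<open>d \<ge> 3\<close> by (cases e) auto
  have K: "subring K (ring_of_type_algebra :: complex ring)"
    by (rule subfieldE(1)[OF assms(1)])
  have one: "1 \<in> K"
    using subringE(3)[OF K] by (simp add: ring_of_type_algebra_def)
  have of_nat: "of_nat k \<in> K" for k
  proof (induction k)
    case 0
    show ?case
      using subringE(2)[OF K] by (simp add: ring_of_type_algebra_def)
  next
    case (Suc k)
    then show ?case
      using one subringE(7)[OF K] by (simp add: ring_of_type_algebra_def)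
  qed
  let ?f = "block_poly n q e d" and ?\<alpha> = "det (mat n n (\<lambda>(i, j). hessian_coeff q e d i j))"
  have "Poly_Mapping.keys (block_monomial q e d j) \<subseteq> {..<n}" if "j < n" for j
    using keys_block_monomial[of q e d j] that q by (auto split: if_splits)
  then have "?f \<in> mpoly_over K n"
    using one by (auto simp: mpoly_over_def block_poly_def keys_sum_of_monomials lookup_sum_of_monomials)
  moreover have "homogeneous d ?f"
    using total_deg_block_monomial[OF d]
    by (auto simp: homogeneous_def block_poly_def keys_sum_of_monomials)
  moreover have "?\<alpha> \<in> K"
    using e \<open>d \<ge> 3\<close> by (intro det_in_subring[OF K]) (simp only: hessian_coeff_eq of_nat)
  moreover have "?\<alpha> \<noteq> 0"
    using d \<open>d \<ge> 3\<close> q by (intro det_hessian_coeff_nonzero) auto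
  moreover have "hessian_det n ?f = Const ?\<alpha> * (\<Prod>i<n. Var i) ^ (d - 2)"
    using d \<open>d \<ge> 3\<close> q by (intro hessian_det_block_poly) auto
  moreover have "?f \<noteq> (\<Sum>i<n. Const (a i) * Var i ^ d)" for a
    by (rule block_poly_not_diagonal[OF q e])
  ultimately show ?thesis
    by blast
qed

end
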